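(* Let $E$ and $E'$ be second countable Stone spaces, each with at least four points, and let $\Phi\colon\mathscr{C}(E)\to\mathscr{C}(E')$ be a graph isomorphism. Then there exists a homeomorphism $f\colon E\to E'$ inducing $\Phi$, i.e. $\Phi(U\sqcup V)=f(U)\sqcup f(V)$ for every non-peripheral cut $U\sqcup V$ of $E$.
   Context: A Stone space is a compact, Hausdorff, totally disconnected space. A cut of $E$ is an unordered partition of $E$ into two disjoint clopen sets $U,V$, written $U\sqcup V$; it is non-peripheral if each of $U,V$ contains at least two points. Two cuts $U\sqcup V$, $U'\sqcup V'$ cross if all four sets $U\cap U'$, $U\cap V'$, $V\cap U'$, $V\cap V'$ are nonempty; otherwise they are compatible. The complex of cuts $\mathscr{C}(E)$ is the simplicial graph whose vertices are the non-peripheral cuts of $E$, with edges between distinct compatible cuts. *)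

theory Defs
  imports "HOL-Analysis.Analysis"
begin

definition totally_disconnected_space :: "'a topology \<Rightarrow> bool" where
  "totally_disconnected_space X \<longleftrightarrow>
     (\<forall>S. S \<subseteq> topspace X \<and> connectedin X S \<longrightarrow> (\<exists>a. S \<subseteq> {a}))"

definition stone_space :: "'a topology \<Rightarrow> bool" where
  "stone_space X \<longleftrightarrow> compact_space X \<and> Hausdorff_space X \<and> totally_disconnected_space X"

definition is_cut :: "'a topology \<Rightarrow> 'a set set \<Rightarrow> bool" where
  "is_cut X c \<longleftrightarrow> (\<exists>U V. c = {U, V} \<and> U \<inter> V = {} \<and> U \<union> V = topspace X \<and>
       openin X U \<and> closedin X U \<and> openin X V \<and> closedin X V)"

definition nonperipheral_cut :: "'a topology \<Rightarrow> 'a set set \<Rightarrow> bool" where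
  "nonperipheral_cut X c \<longleftrightarrow> (\<exists>U V. c = {U, V} \<and> U \<inter> V = {} \<and> U \<union> V = topspace X \<and>
       openin X U \<and> closedin X U \<and> openin X V \<and> closedin X V \<and>
       (\<exists>x y. x \<in> U \<and> y \<in> U \<and> x \<noteq> y) \<and> (\<exists>x y. x \<in> V \<and> y \<in> V \<and> x \<noteq> y))"

definition cut_vertices :: "'a topology \<Rightarrow> 'a set set set" where
  "cut_vertices X = {c. nonperipheral_cut X c}"

definition cuts_cross :: "'a set set \<Rightarrow> 'a set set \<Rightarrow> bool" where
  "cuts_cross c d \<longleftrightarrow> (\<forall>A\<in>c. \<forall>B\<in>d. A \<inter> B \<noteq> {})"

definition cut_adj :: "'a topology \<Rightarrow> 'a set set \<Rightarrow> 'a set set \<Rightarrow> bool" where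
  "cut_adj X c d \<longleftrightarrow> c \<in> cut_vertices X \<and> d \<in> cut_vertices X \<and> c \<noteq> d \<and> \<not> cuts_cross c d"

definition cut_complex_iso :: "'a topology \<Rightarrow> 'b topology \<Rightarrow> ('a set set \<Rightarrow> 'b set set) \<Rightarrow> bool" where
  "cut_complex_iso X Y \<Phi> \<longleftrightarrow> bij_betw \<Phi> (cut_vertices X) (cut_vertices Y) \<and>
     (\<forall>c\<in>cut_vertices X. \<forall>d\<in>cut_vertices X. cut_adj Y (\<Phi> c) (\<Phi> d) \<longleftrightarrow> cut_adj X c d)"

end

theory Submission
  imports Defs
begin

text \<open>
  Call a clopen set with at least two points inside and outside a side. The cuts adjacent to a
  cut \<open>{U, V}\<close> are those with a side properly contained in \<open>U\<close> or in \<open>V\<close>. Two cuts in \<open>U\<close> are always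
  crossed by a common third one in \<open>U\<close> (up to equality), while cuts in \<open>U\<close> never cross cuts in \<open>V\<close>;
  so the graph knows which neighbours of a cut lie on the same side. With at least five points,
  one of \<open>U\<close>, \<open>V\<close> contains a cut, hence a graph isomorphism induces a map \<open>\<phi>\<close> on sides,
  which preserves complements and inclusion. For a point \<open>x\<close>, the sets \<open>\<phi> U\<close> with \<open>x \<in> U\<close> have
  exactly one common point, by compactness if the sides around \<open>x\<close> are closed under intersection, and
  because any three such sets meet otherwise; this defines the homeomorphism. Spaces with four
  points are exactly those whose graph has no edges; there, two crossing cuts label the four points.
\<close>

section \<open>Sides of cuts\<close>

abbreviation clopenin :: "'a topology \<Rightarrow> 'a set \<Rightarrow> bool" where
  "clopenin X U \<equiv> openin X U \<and> closedin X U"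

text \<open>Stated without \<open>card\<close>, which is 0 on infinite sets.\<close>

definition many :: "'a set \<Rightarrow> bool" where
  "many A \<longleftrightarrow> (\<exists>x\<in>A. \<exists>y\<in>A. x \<noteq> y)"

text \<open>A side is an oriented non-peripheral cut: each vertex of the graph has exactly two
  sides, exchanged by complement. Unlike cuts, sides can be compared by inclusion.\<close>

definition sides :: "'a topology \<Rightarrow> 'a set set" where
  "sides X = {U. clopenin X U \<and> many U \<and> many (topspace X - U)}"

definition cut_of :: "'a topology \<Rightarrow> 'a set \<Rightarrow> 'a set set" where
  "cut_of X U = {U, topspace X - U}"

text \<open>For a side \<open>U\<close> this is one half of the link of \<open>cut_of X U\<close>;
  the other half is \<open>cuts_in X (topspace X - U)\<close>.\<close>

definition cuts_in :: "'a topology \<Rightarrow> 'a set \<Rightarrow> 'a set set set" where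
  "cuts_in X U = cut_of X ` {A \<in> sides X. A \<subset> U}"

text \<open>Mentions adjacency only, so graph isomorphisms preserve it. Between vertices,
  non-adjacency means crossing or equality; in particular \<open>h = d\<close> is allowed.\<close>

definition same_side :: "'a topology \<Rightarrow> 'a set set \<Rightarrow> 'a set set \<Rightarrow> 'a set set \<Rightarrow> bool" where
  "same_side X c d e \<longleftrightarrow> cut_adj X c d \<and> cut_adj X c e \<and>
     (\<exists>h. cut_adj X c h \<and> \<not> cut_adj X h d \<and> \<not> cut_adj X h e)"

lemma many_iff: "many A \<longleftrightarrow> (\<exists>x y. x \<in> A \<and> y \<in> A \<and> x \<noteq> y)"
  unfolding many_def by blast

lemma manyI: "x \<in> A \<Longrightarrow> y \<in> A \<Longrightarrow> x \<noteq> y \<Longrightarrow> many A"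
  unfolding many_def by blast

lemma many_mono: "many A \<Longrightarrow> A \<subseteq> B \<Longrightarrow> many B"
  unfolding many_def by blast

lemma many_nonempty: "many A \<Longrightarrow> A \<noteq> {}"
  unfolding many_def by blast

lemma sidesD:
  assumes "U \<in> sides X"
  shows "openin X U" "closedin X U" "U \<subseteq> topspace X" "U \<noteq> {}" "topspace X - U \<noteq> {}"
    "many U" "many (topspace X - U)"
  using assms openin_subset many_nonempty unfolding sides_def by blast+

lemma compl_compl: "U \<in> sides X \<Longrightarrow> topspace X - (topspace X - U) = U"
  using sidesD(3) by blast

lemma compl_sides:
  assumes "U \<in> sides X"
  shows "topspace X - U \<in> sides X"
proof -
  have "openin X (topspace X - U)" "closedin X (topspace X - U)"
    using sidesD(1,2)[OF assms] by blast+
  then show ?thesis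
    using sidesD(6,7)[OF assms] compl_compl[OF assms] unfolding sides_def by simp
qed

lemma cut_of_compl: "U \<in> sides X \<Longrightarrow> cut_of X (topspace X - U) = cut_of X U"
  unfolding cut_of_def by (auto simp: compl_compl)

lemma cut_of_eq_iff:
  "A \<in> sides X \<Longrightarrow> B \<in> sides X \<Longrightarrow>
   cut_of X A = cut_of X B \<longleftrightarrow> A = B \<or> A = topspace X - B"
  unfolding cut_of_def using compl_compl[of A X] compl_compl[of B X] by (auto simp: doubleton_eq_iff)

lemma nonperipheral_cut_iff:
  "nonperipheral_cut X {U, V} \<longleftrightarrow> U \<in> sides X \<and> V = topspace X - U"
proof
  assume "nonperipheral_cut X {U, V}"
  then obtain A B where e: "{U, V} = {A, B}" and AB: "A \<inter> B = {}" "A \<union> B = topspace X"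
      "clopenin X A" "clopenin X B" "many A" "many B"
    unfolding nonperipheral_cut_def many_iff[symmetric] by force
  have "A = topspace X - B" "B = topspace X - A" using AB by blast+
  then have "A \<in> sides X" "B \<in> sides X" "topspace X - A = B" "topspace X - B = A"
    using AB unfolding sides_def by auto
  with e show "U \<in> sides X \<and> V = topspace X - U" by (auto simp: doubleton_eq_iff)
next
  assume "U \<in> sides X \<and> V = topspace X - U"
  then have U: "U \<in> sides X" and V: "V = topspace X - U" by auto
  have "U \<inter> V = {}" "U \<union> V = topspace X" using V sidesD(3)[OF U] by blast+
  moreover have "clopenin X V" using sidesD[OF compl_sides[OF U]] V by blast
  ultimately show "nonperipheral_cut X {U, V}"
    unfolding nonperipheral_cut_def many_iff[symmetric] using sidesD[OF U] V
    by (intro exI[of _ U] exI[of _ V]) simp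
qed

lemma cut_vertices_eq: "cut_vertices X = cut_of X ` sides X"
proof -
  have "c \<in> cut_vertices X \<longleftrightarrow> c \<in> cut_of X ` sides X" for c
  proof
    assume "c \<in> cut_vertices X"
    then have np: "nonperipheral_cut X c" by (simp add: cut_vertices_def)
    then obtain U V where c: "c = {U, V}" unfolding nonperipheral_cut_def by blast
    then show "c \<in> cut_of X ` sides X"
      using np nonperipheral_cut_iff[of X U V] unfolding cut_of_def by blast
  next
    assume "c \<in> cut_of X ` sides X"
    then show "c \<in> cut_vertices X"
      unfolding cut_of_def cut_vertices_def using nonperipheral_cut_iff by blast
  qed
  then show ?thesis by blast
qed

section \<open>Adjacency and links in terms of inclusion of sides\<close>

text \<open>An empty corner of two cuts is an inclusion between a side of one and a side of the
  other, strict because the cuts differ. Conversely, a strict inclusion rules out equal cuts since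
  sides and their complements are nonempty.\<close>

lemma cut_adj_cut_of_iff:
  assumes "A \<in> sides X" "B \<in> sides X"
  shows "cut_adj X (cut_of X A) (cut_of X B) \<longleftrightarrow>
    A \<subset> B \<or> A \<subset> topspace X - B \<or> topspace X - A \<subset> B \<or> topspace X - A \<subset> topspace X - B"
proof -
  let ?T = "topspace X"
  have sub: "A \<subseteq> ?T" "B \<subseteq> ?T" using assms sidesD(3) by blast+
  have adj: "cut_adj X (cut_of X A) (cut_of X B) \<longleftrightarrow> A \<noteq> B \<and> A \<noteq> ?T - B \<and>
      (A \<inter> B = {} \<or> A \<inter> (?T - B) = {} \<or> (?T - A) \<inter> B = {} \<or> (?T - A) \<inter> (?T - B) = {})"
    using assms unfolding cut_adj_def cut_vertices_eq cuts_cross_def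
    by (simp add: cut_of_eq_iff) (simp add: cut_of_def)
  show ?thesis
  proof (cases "A = B \<or> A = ?T - B")
    case True
    then show ?thesis
      using adj sub sidesD(4,5)[OF assms(1)] sidesD(4,5)[OF assms(2)] by auto
  next
    case False
    have "A \<inter> B = {} \<longleftrightarrow> A \<subset> ?T - B" "A \<inter> (?T - B) = {} \<longleftrightarrow> A \<subset> B"
      "(?T - A) \<inter> B = {} \<longleftrightarrow> ?T - A \<subset> ?T - B" "(?T - A) \<inter> (?T - B) = {} \<longleftrightarrow> ?T - A \<subset> B"
      using sub False by auto
    then show ?thesis using adj False by (simp add: disj_ac)
  qed
qed

lemma not_cut_adj_if_crossing:
  assumes "A \<in> sides X" "B \<in> sides X" "A \<inter> B \<noteq> {}" "A - B \<noteq> {}" "B - A \<noteq> {}" "topspace X - (A \<union> B) \<noteq> {}"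
  shows "\<not> cut_adj X (cut_of X A) (cut_of X B)"
proof -
  have "\<not> A \<subseteq> B" "\<not> A \<subseteq> topspace X - B" "\<not> topspace X - A \<subseteq> B" "\<not> topspace X - A \<subseteq> topspace X - B"
    using assms(3-) sidesD(3)[OF assms(2)] by blast+
  then show ?thesis unfolding cut_adj_cut_of_iff[OF assms(1,2)] psubset_eq by blast
qed

lemma not_cut_adj_refl: "\<not> cut_adj X c c"
  unfolding cut_adj_def by blast

lemma cut_adjD: "cut_adj X c d \<Longrightarrow> c \<in> cut_vertices X \<and> d \<in> cut_vertices X"
  unfolding cut_adj_def by blast

lemma cuts_in_subset: "cuts_in X U \<subseteq> cut_vertices X"
  unfolding cuts_in_def cut_vertices_eq by blast

lemma cut_of_in_cuts_in_iff:
  assumes "A \<in> sides X"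
  shows "cut_of X A \<in> cuts_in X U \<longleftrightarrow> A \<subset> U \<or> topspace X - A \<subset> U"
proof
  assume "cut_of X A \<in> cuts_in X U"
  then obtain B where "B \<in> sides X" "B \<subset> U" "cut_of X A = cut_of X B" unfolding cuts_in_def by blast
  then show "A \<subset> U \<or> topspace X - A \<subset> U" using assms cut_of_eq_iff compl_compl by metis
next
  assume "A \<subset> U \<or> topspace X - A \<subset> U"
  then show "cut_of X A \<in> cuts_in X U"
    unfolding cuts_in_def using assms compl_sides[OF assms] cut_of_compl[OF assms] by blast
qed

text \<open>After taking complements, each of the four inclusions expressing adjacency puts a side
  of the other cut properly inside \<open>U\<close> or inside its complement.\<close>

lemma link_eq:
  assumes "U \<in> sides X"
  shows "{d. cut_adj X (cut_of X U) d} = cuts_in X U \<union> cuts_in X (topspace X - U)"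
proof -
  have "cut_adj X (cut_of X U) (cut_of X A) \<longleftrightarrow>
      cut_of X A \<in> cuts_in X U \<union> cuts_in X (topspace X - U)" if "A \<in> sides X" for A
    using sidesD(3)[OF assms] sidesD(3)[OF that]
    unfolding cut_adj_cut_of_iff[OF assms that] Un_iff cut_of_in_cuts_in_iff[OF that] by blast
  then show ?thesis
    using cuts_in_subset[of X] cut_adjD[of X] unfolding cut_vertices_eq by blast
qed

text \<open>Sides \<open>A\<close> and \<open>B\<close> inside \<open>U\<close> and its complement
  are disjoint and nonempty, hence distinct, and they do not cover the space, hence are not
  complementary.\<close>

lemma cuts_in_disjoint:
  assumes "U \<in> sides X"
  shows "cuts_in X U \<inter> cuts_in X (topspace X - U) = {}"
proof -
  have False if A: "A \<in> sides X" and B: "B \<in> sides X" and "A \<subset> U" "B \<subset> topspace X - U"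
    and e: "cut_of X A = cut_of X B" for A B
    using that(3,4) cut_of_eq_iff[OF A B] sidesD[OF A] sidesD[OF B] e by blast
  then show ?thesis unfolding cuts_in_def by blast
qed

section \<open>Recovering sides from the graph\<close>

text \<open>The component of \<open>x\<close> is the compact set \<open>{x}\<close>. In a locally
  compact Hausdorff space, a compact component inside an open set, here the complement of
  \<open>y\<close>, has a clopen neighbourhood inside that set.\<close>

lemma stone_separation:
  assumes "stone_space X" "x \<in> topspace X" "y \<in> topspace X" "x \<noteq> y"
  obtains K where "clopenin X K" "x \<in> K" "y \<notin> K"
proof -
  have cH: "compact_space X" "Hausdorff_space X" "totally_disconnected_space X"
    using assms unfolding stone_space_def by auto
  let ?C = "connected_component_of_set X x"
  have "x \<in> ?C" using assms by (simp add: connected_component_of_refl)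
  then have C: "?C = {x}"
    using cH(3) connectedin_connected_component_of[of X x] connectedin_subset_topspace
    unfolding totally_disconnected_space_def by (metis subset_singletonD empty_iff singletonD)
  have "{x} \<in> connected_components_of X"
    unfolding connected_components_of_def using C assms(2) by (metis image_eqI)
  moreover have "openin X (topspace X - {y})"
    using assms cH by (simp add: Hausdorff_imp_t1_space closedin_t1_singleton openin_diff)
  moreover have "compactin X {x}" using assms by simp
  ultimately obtain U V where UV: "openin X U" "openin X V" "disjnt U V" "U \<union> V = topspace X"
      "{x} \<subseteq> U" "U \<subseteq> topspace X - {y}"
    using wilder_locally_compact_component_thm[OF compact_imp_locally_compact_space[OF cH(1)] cH(2)] assms
    by (metis Diff_iff empty_subsetI insert_subset singletonD)
  have "U = topspace X - V" using UV by (auto simp: disjnt_def)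
  then have "closedin X U" using UV(2) by blast
  then show thesis using that[of U] UV by blast
qed

lemma split_clopen:
  assumes "stone_space X" "clopenin X A" "x \<in> A" "y \<in> A" "x \<noteq> y"
  obtains A1 A2 where "clopenin X A1" "clopenin X A2" "x \<in> A1" "y \<in> A2" "A1 \<inter> A2 = {}" "A1 \<union> A2 = A"
proof -
  have "A \<subseteq> topspace X" using assms openin_subset by blast
  then obtain K where K: "clopenin X K" "x \<in> K" "y \<notin> K"
    using stone_separation[of X x y] assms by blast
  show thesis
    using K assms that[of "A \<inter> K" "A - K"] by (auto simp: openin_diff closedin_diff)
qed

section \<open>Distinguishing the two halves of a link\<close>

text \<open>A suitable \<open>D\<close> is built from clopen pieces of \<open>A\<close>,
  \<open>B\<close> and \<open>U\<close>, according to whether \<open>A\<close> and \<open>B\<close>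
  are equal, nested, disjoint or crossing.\<close>

lemma common_crossing:
  assumes X: "stone_space X" and U: "U \<in> sides X"
    and A: "A \<in> sides X" "A \<subset> U" and B: "B \<in> sides X" "B \<subset> U"
  obtains D where "D \<in> sides X" "D \<subset> U" "\<not> cut_adj X (cut_of X D) (cut_of X A)"
    "\<not> cut_adj X (cut_of X D) (cut_of X B)"
proof -
  note result = that
  \<comment> \<open>For sets inside \<open>U\<close> only three corners need checking: the fourth
    contains the nonempty complement of \<open>U\<close>.\<close>
  have conc: thesis if D: "clopenin X D" "D \<subset> U"
    "D = A \<or> D \<inter> A \<noteq> {} \<and> D - A \<noteq> {} \<and> A - D \<noteq> {}" "D = B \<or> D \<inter> B \<noteq> {} \<and> D - B \<noteq> {} \<and> B - D \<noteq> {}" for D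
  proof -
    have "many D"
    proof (cases "D = A")
      case False
      then obtain x y where "x \<in> D \<inter> A" "y \<in> D - A" using D(3) by blast
      then show ?thesis using manyI[of x D y] by auto
    qed (use sidesD(6)[OF A(1)] in simp)
    moreover have "many (topspace X - D)"
      using D(2) by (intro many_mono[OF sidesD(7)[OF U]]) blast
    ultimately have "D \<in> sides X" using D(1) unfolding sides_def by simp
    moreover have "topspace X - (D \<union> A) \<noteq> {}" "topspace X - (D \<union> B) \<noteq> {}"
      using D(2) A(2) B(2) sidesD(5)[OF U] by blast+
    then have "\<not> cut_adj X (cut_of X D) (cut_of X A)" "\<not> cut_adj X (cut_of X D) (cut_of X B)"
      using D(3,4) not_cut_adj_if_crossing[OF \<open>D \<in> sides X\<close> A(1)]
        not_cut_adj_if_crossing[OF \<open>D \<in> sides X\<close> B(1)] not_cut_adj_refl by metis+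
    ultimately show thesis
      using result[of D] D(2) by blast
  qed
  have cl: "clopenin X (S - T)" "clopenin X (S \<union> T)" if "clopenin X S" "clopenin X T" for S T
    using that by (auto simp: openin_diff closedin_diff)
  have clA: "clopenin X A" and clB: "clopenin X B" and clU: "clopenin X U"
    using sidesD(1,2) A(1) B(1) U by blast+
  obtain a a' where a: "a \<in> A" "a' \<in> A" "a \<noteq> a'" using sidesD(6)[OF A(1)] unfolding many_def by blast
  obtain b b' where b: "b \<in> B" "b' \<in> B" "b \<noteq> b'" using sidesD(6)[OF B(1)] unfolding many_def by blast
  obtain A1 A2 where A12: "clopenin X A1" "clopenin X A2" "a \<in> A1" "a' \<in> A2" "A1 \<inter> A2 = {}" "A1 \<union> A2 = A"
    by (rule split_clopen[OF X clA a])
  obtain B1 B2 where B12: "clopenin X B1" "clopenin X B2" "b \<in> B1" "b' \<in> B2" "B1 \<inter> B2 = {}" "B1 \<union> B2 = B"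
    by (rule split_clopen[OF X clB b])
  consider "A = B" | "A \<subset> B" | "B \<subset> A" | "A \<inter> B = {}" | "A \<inter> B \<noteq> {}" "A - B \<noteq> {}" "B - A \<noteq> {}" by blast
  then show thesis
  proof cases
    case 1
    then show thesis using conc[OF clA A(2)] by simp
  next
    case 2
    \<comment> \<open>Take half of the smaller set together with \<open>U - B\<close>:
      \<open>D\<close> meets both sets in \<open>a\<close>, misses \<open>a'\<close> from both, and
      leaves both at \<open>u\<close>.\<close>
    obtain u where u: "u \<in> U" "u \<notin> B" using B(2) by blast
    have "a \<in> A1 \<union> (U - B)" "u \<in> A1 \<union> (U - B)" "u \<notin> A" "a' \<notin> A1 \<union> (U - B)" "a \<in> B" "a' \<in> B"
      using 2 a u A12(3-6) by blast+
    moreover have "A1 \<union> (U - B) \<subset> U"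
      using 2 A(2) a(2) A12(4-6) calculation(4) by blast
    ultimately show thesis
      using a u cl(2)[OF A12(1) cl(1)[OF clU clB]] by (intro conc[of "A1 \<union> (U - B)"]) blast+
  next
    case 3
    obtain u where u: "u \<in> U" "u \<notin> A" using A(2) by blast
    have "b \<in> B1 \<union> (U - A)" "u \<in> B1 \<union> (U - A)" "u \<notin> B" "b' \<notin> B1 \<union> (U - A)" "b \<in> A" "b' \<in> A"
      using 3 b u B12(3-6) by blast+
    moreover have "B1 \<union> (U - A) \<subset> U"
      using 3 B(2) b(2) B12(4-6) calculation(4) by blast
    ultimately show thesis
      using b u cl(2)[OF B12(1) cl(1)[OF clU clA]] by (intro conc[of "B1 \<union> (U - A)"]) blast+
  next
    case 4
    \<comment> \<open>For disjoint sets take half of each: the half of one set is the part of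
      \<open>D\<close> outside the other.\<close>
    have "a \<in> A1 \<union> B1" "a' \<notin> A1 \<union> B1" "b \<in> A1 \<union> B1" "b' \<notin> A1 \<union> B1" "a \<notin> B" "b \<notin> A"
    proof -
      have "a' \<notin> A1" "b' \<notin> B1" using A12(4,5) B12(4,5) by blast+
      moreover have "A1 \<subseteq> A" "B1 \<subseteq> B" using A12(6) B12(6) by blast+
      ultimately show "a \<in> A1 \<union> B1" "a' \<notin> A1 \<union> B1" "b \<in> A1 \<union> B1" "b' \<notin> A1 \<union> B1" "a \<notin> B" "b \<notin> A"
        using 4 a(1,2) b(1,2) A12(3) B12(3) by auto
    qed
    moreover have "A1 \<union> B1 \<subset> U"
      using A(2) B(2) a(2) A12(6) B12(6) calculation(2) by blast
    ultimately show thesis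
      using a b cl(2)[OF A12(1) B12(1)] by (intro conc[of "A1 \<union> B1"]) blast+
  next
    case 5
    \<comment> \<open>Here \<open>A\<close> and \<open>B\<close> already cross, so
      \<open>D = A\<close> works.\<close>
    then show thesis using conc[OF clA A(2)] by blast
  qed
qed

text \<open>A half of the link is recovered from the graph and any one of its members
  \<open>d\<close>. Two cuts in the same half have a common \<open>h\<close> by
  \<open>common_crossing\<close>; conversely, cuts in opposite halves are adjacent, so
  \<open>h\<close> lies in the half of \<open>d\<close>, and then \<open>e\<close> in the half of
  \<open>h\<close>.\<close>

lemma cuts_in_eq_same_side:
  assumes X: "stone_space X" and U: "U \<in> sides X" and d: "d \<in> cuts_in X U"
  shows "cuts_in X U = {e. same_side X (cut_of X U) d e}"
proof (intro equalityI subsetI)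
  fix e assume e: "e \<in> cuts_in X U"
  obtain A B where A: "A \<in> sides X" "A \<subset> U" "d = cut_of X A" and B: "B \<in> sides X" "B \<subset> U" "e = cut_of X B"
    using d e unfolding cuts_in_def by blast
  obtain D where D: "D \<in> sides X" "D \<subset> U" "\<not> cut_adj X (cut_of X D) d" "\<not> cut_adj X (cut_of X D) e"
    using common_crossing[OF X U A(1,2) B(1,2)] A(3) B(3) by blast
  have "cut_of X D \<in> cuts_in X U" using D unfolding cuts_in_def by blast
  then show "e \<in> {e. same_side X (cut_of X U) d e}"
    using link_eq[OF U] d e D unfolding same_side_def by blast
next
  fix e assume "e \<in> {e. same_side X (cut_of X U) d e}"
  then obtain h where h: "cut_adj X (cut_of X U) h" "\<not> cut_adj X h d" "\<not> cut_adj X h e"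
    and e: "cut_adj X (cut_of X U) e" unfolding same_side_def by blast
  have far: "cut_adj X (cut_of X H) (cut_of X A)"
    if "H \<in> sides X" "A \<in> sides X" "H \<subset> V" "A \<subset> topspace X - V" for H A V
  proof -
    have "H \<subset> topspace X - A" using that sidesD(3)[of H X] by blast
    then show ?thesis using that by (simp add: cut_adj_cut_of_iff)
  qed
  have far1: "cut_adj X g a" if "g \<in> cuts_in X V" "a \<in> cuts_in X (topspace X - V)" for g a V
    using that far unfolding cuts_in_def by blast
  have "h \<in> cuts_in X U"
    using far1[of h "topspace X - U" d] compl_compl[OF U] h link_eq[OF U] d by auto
  then show "e \<in> cuts_in X U"
    using far1[of h U e] h e link_eq[OF U] by blast
qed


section \<open>Nonempty halves of links\<close>

text \<open>Split \<open>U\<close> into clopen pieces separating \<open>x\<close> from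
  \<open>y\<close>. The piece containing \<open>z\<close> has two points, and its complement is
  large because it contains that of \<open>U\<close>.\<close>

lemma cuts_in_nonempty:
  assumes X: "stone_space X" and U: "U \<in> sides X"
    and xyz: "x \<in> U" "y \<in> U" "z \<in> U" "x \<noteq> y" "x \<noteq> z" "y \<noteq> z"
  shows "cuts_in X U \<noteq> {}"
proof -
  obtain U1 U2 where U12: "clopenin X U1" "clopenin X U2" "x \<in> U1" "y \<in> U2" "U1 \<inter> U2 = {}" "U1 \<union> U2 = U"
    using split_clopen[OF X _ xyz(1,2,4)] sidesD(1,2)[OF U] by metis
  have in_sides: "V \<in> sides X" if "clopenin X V" "V \<subset> U" "many V" for V
    using that many_mono[OF sidesD(7)[OF U], of "topspace X - V"] unfolding sides_def by blast
  have sub: "U1 \<subset> U" "U2 \<subset> U" using U12(3-6) by blast+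
  have "many U1 \<or> many U2"
    using U12(3,4,6) xyz(3,5,6) manyI[of x U1 z] manyI[of y U2 z] by blast
  then show ?thesis
    unfolding cuts_in_def using in_sides[OF U12(1) sub(1)] in_sides[OF U12(2) sub(2)] sub by blast
qed

text \<open>Here and below, \<open>\<not> topspace X \<subseteq> {a, b, c, d}\<close> for all \<open>a b c d\<close> says that the space has at
  least five points.\<close>

lemma link_nonempty:
  assumes X: "stone_space X" and wide: "\<And>a b c d. \<not> topspace X \<subseteq> {a, b, c, d}" and U: "U \<in> sides X"
  shows "cuts_in X U \<noteq> {} \<or> cuts_in X (topspace X - U) \<noteq> {}"
proof -
  \<comment> \<open>A side with no cut inside has at most two points, so two complementary such
    sides would give at most four points in all.\<close>
  have pair: "\<exists>a b. V \<subseteq> {a, b}" if V: "V \<in> sides X" and "cuts_in X V = {}" for V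
  proof -
    obtain x y where "x \<in> V" "y \<in> V" "x \<noteq> y" using sidesD(6)[OF V] unfolding many_def by blast
    then have "V \<subseteq> {x, y}" using cuts_in_nonempty[OF X V] that(2) by blast
    then show ?thesis by blast
  qed
  show ?thesis
  proof (rule ccontr)
    assume "\<not> ?thesis"
    then obtain a b c d where "U \<subseteq> {a, b}" "topspace X - U \<subseteq> {c, d}"
      using pair[OF U] pair[OF compl_sides[OF U]] by meson
    then have "topspace X \<subseteq> {a, b, c, d}" by blast
    then show False using wide by blast
  qed
qed

text \<open>The first condition allows \<open>U \<subset> W\<close> or
  \<open>topspace X - U \<subset> W\<close>. In the latter case
  \<open>topspace X - W \<subset> U\<close>, which the second condition excludes.\<close>

lemma psubset_iff_cuts_in:
  assumes U: "U \<in> sides X" and W: "W \<in> sides X"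
  shows "U \<subset> W \<longleftrightarrow> cut_of X U \<in> cuts_in X W \<and> cut_of X W \<notin> cuts_in X U"
  unfolding cut_of_in_cuts_in_iff[OF U] cut_of_in_cuts_in_iff[OF W]
  using sidesD(3-5)[OF U] sidesD(3-5)[OF W] by auto

section \<open>Transport of sides along a graph isomorphism\<close>

lemma same_side_iso:
  assumes iso: "cut_complex_iso X Y \<Phi>" and "c \<in> cut_vertices X" "d \<in> cut_vertices X"
  shows "{e. same_side Y (\<Phi> c) (\<Phi> d) e} = \<Phi> ` {e. same_side X c d e}"
proof -
  have adj: "cut_adj Y (\<Phi> a) (\<Phi> b) \<longleftrightarrow> cut_adj X a b" if "a \<in> cut_vertices X" "b \<in> cut_vertices X" for a b
    using iso that unfolding cut_complex_iso_def by blast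
  have im: "\<Phi> ` cut_vertices X = cut_vertices Y"
    using iso unfolding cut_complex_iso_def bij_betw_def by blast
  have "same_side Y (\<Phi> c) (\<Phi> d) (\<Phi> e) \<longleftrightarrow> same_side X c d e" if e: "e \<in> cut_vertices X" for e
  proof -
    \<comment> \<open>Adjacency forces \<open>h\<close> to be a vertex, so surjectivity of
      \<open>\<Phi>\<close> lets the quantifier range over images of vertices of
      \<open>X\<close>.\<close>
    have "(\<exists>h. cut_adj Y (\<Phi> c) h \<and> \<not> cut_adj Y h (\<Phi> d) \<and> \<not> cut_adj Y h (\<Phi> e)) \<longleftrightarrow>
      (\<exists>h\<in>cut_vertices Y. cut_adj Y (\<Phi> c) h \<and> \<not> cut_adj Y h (\<Phi> d) \<and> \<not> cut_adj Y h (\<Phi> e))"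
      using cut_adjD[of Y] by blast
    also have "\<dots> \<longleftrightarrow> (\<exists>h\<in>cut_vertices X. cut_adj X c h \<and> \<not> cut_adj X h d \<and> \<not> cut_adj X h e)"
      unfolding im[symmetric] using adj assms(2,3) e by simp
    also have "\<dots> \<longleftrightarrow> (\<exists>h. cut_adj X c h \<and> \<not> cut_adj X h d \<and> \<not> cut_adj X h e)"
      using cut_adjD[of X] by blast
    finally show ?thesis
      unfolding same_side_def using adj assms(2,3) e by simp
  qed
  moreover have "e \<in> cut_vertices Y" if "same_side Y (\<Phi> c) (\<Phi> d) e" for e
    using that cut_adjD[of Y] unfolding same_side_def by blast
  moreover have "e \<in> cut_vertices X" if "same_side X c d e" for e
    using that cut_adjD[of X] unfolding same_side_def by blast
  ultimately show ?thesis using im by (auto simp: image_iff) (metis imageE)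
qed

text \<open>The image cut determines \<open>V\<close> only up to complement; the condition on the
  halves of the links is what chooses the orientation.\<close>

definition corresponding :: "'a topology \<Rightarrow> 'b topology \<Rightarrow> ('a set set \<Rightarrow> 'b set set) \<Rightarrow> 'a set \<Rightarrow> 'b set \<Rightarrow> bool" where
  "corresponding X Y \<Phi> U V \<longleftrightarrow>
     V \<in> sides Y \<and> cut_of Y V = \<Phi> (cut_of X U) \<and> cuts_in Y V = \<Phi> ` cuts_in X U"

lemma Un_cancel_left:
  assumes "A \<union> B = A \<union> C" "A \<inter> B = {}" "A \<inter> C = {}"
  shows "B = C"
  using assms by blast

text \<open>\<open>\<Phi>\<close> maps link onto link, and on both ends the link is the disjoint
  union of two halves. Once one half is matched, so is the other.\<close>

lemma corresponding_compl:
  assumes iso: "cut_complex_iso X Y \<Phi>" and U: "U \<in> sides X" and V: "corresponding X Y \<Phi> U V"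
  shows "corresponding X Y \<Phi> (topspace X - U) (topspace Y - V)"
proof -
  have bij: "bij_betw \<Phi> (cut_vertices X) (cut_vertices Y)"
    and adj: "\<And>a b. a \<in> cut_vertices X \<Longrightarrow> b \<in> cut_vertices X \<Longrightarrow> cut_adj Y (\<Phi> a) (\<Phi> b) \<longleftrightarrow> cut_adj X a b"
    using iso unfolding cut_complex_iso_def by blast+
  have V: "V \<in> sides Y" "cut_of Y V = \<Phi> (cut_of X U)" "cuts_in Y V = \<Phi> ` cuts_in X U"
    using V unfolding corresponding_def by auto
  have c: "cut_of X U \<in> cut_vertices X" using U unfolding cut_vertices_eq by blast
  have "{e. cut_adj Y (\<Phi> (cut_of X U)) e} = \<Phi> ` {e. cut_adj X (cut_of X U) e}"
  proof (intro equalityI subsetI)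
    fix e assume e: "e \<in> {e. cut_adj Y (\<Phi> (cut_of X U)) e}"
    then obtain d where "d \<in> cut_vertices X" "e = \<Phi> d"
      using bij cut_adjD[of Y] unfolding bij_betw_def by blast
    then show "e \<in> \<Phi> ` {e. cut_adj X (cut_of X U) e}" using e adj[OF c] by blast
  next
    fix e assume "e \<in> \<Phi> ` {e. cut_adj X (cut_of X U) e}"
    then show "e \<in> {e. cut_adj Y (\<Phi> (cut_of X U)) e}" using adj[OF c] cut_adjD[of X] by blast
  qed
  then have un: "cuts_in Y V \<union> cuts_in Y (topspace Y - V) =
      \<Phi> ` cuts_in X U \<union> \<Phi> ` cuts_in X (topspace X - U)"
    using link_eq[OF U] link_eq[OF V(1)] V(2) by (simp add: image_Un)
  have "\<Phi> ` cuts_in X U \<inter> \<Phi> ` cuts_in X (topspace X - U) = \<Phi> ` (cuts_in X U \<inter> cuts_in X (topspace X - U))"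
    using bij cuts_in_subset[of X] unfolding bij_betw_def by (intro inj_on_image_Int[symmetric, of _ "cut_vertices X"]) auto
  then have "\<Phi> ` cuts_in X U \<inter> \<Phi> ` cuts_in X (topspace X - U) = {}"
    using cuts_in_disjoint[OF U] by simp
  then have "cuts_in Y (topspace Y - V) = \<Phi> ` cuts_in X (topspace X - U)"
    by (intro Un_cancel_left[OF un[folded V(3)] cuts_in_disjoint[OF V(1)]]) (simp add: V(3))
  then show ?thesis
    unfolding corresponding_def using compl_sides[OF V(1)] cut_of_compl[OF V(1)] cut_of_compl[OF U] V(2) by simp
qed

lemma corresponding_exists:
  assumes X: "stone_space X" and Y: "stone_space Y" and wide: "\<And>a b c d. \<not> topspace X \<subseteq> {a, b, c, d}"
    and iso: "cut_complex_iso X Y \<Phi>" and U: "U \<in> sides X"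
  obtains V where "corresponding X Y \<Phi> U V"
proof -
  have im: "\<Phi> ` cut_vertices X = cut_vertices Y"
    and adj: "\<And>a b. a \<in> cut_vertices X \<Longrightarrow> b \<in> cut_vertices X \<Longrightarrow> cut_adj Y (\<Phi> a) (\<Phi> b) \<longleftrightarrow> cut_adj X a b"
    using iso unfolding cut_complex_iso_def bij_betw_def by blast+
  have main: "\<exists>V. corresponding X Y \<Phi> U V" if U: "U \<in> sides X" and d: "d \<in> cuts_in X U" for U d
  proof -
    have c: "cut_of X U \<in> cut_vertices X" using U unfolding cut_vertices_eq by blast
    have dv: "d \<in> cut_vertices X" using d cuts_in_subset by blast
    have "cut_adj X (cut_of X U) d" using link_eq[OF U] d by blast
    then have a: "cut_adj Y (\<Phi> (cut_of X U)) (\<Phi> d)" using adj[OF c dv] by blast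
    have "\<Phi> (cut_of X U) \<in> cut_of Y ` sides Y" using c im cut_vertices_eq by blast
    then obtain V' where V': "V' \<in> sides Y" "\<Phi> (cut_of X U) = cut_of Y V'" by blast
    have "\<Phi> d \<in> cuts_in Y V' \<or> \<Phi> d \<in> cuts_in Y (topspace Y - V')"
      using a link_eq[OF V'(1)] V'(2) by auto
    \<comment> \<open>Of the two sides of the image cut, take the one whose half of the link
      contains the image of \<open>d\<close>.\<close>
    then obtain V where V: "V \<in> sides Y" "\<Phi> (cut_of X U) = cut_of Y V" "\<Phi> d \<in> cuts_in Y V"
      using V' compl_sides[OF V'(1)] cut_of_compl[OF V'(1)] by metis
    have "cuts_in Y V = {e. same_side Y (\<Phi> (cut_of X U)) (\<Phi> d) e}"
      unfolding V(2) by (rule cuts_in_eq_same_side[OF Y V(1,3)])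
    also have "\<dots> = \<Phi> ` cuts_in X U"
      using same_side_iso[OF iso c dv] cuts_in_eq_same_side[OF X U d] by simp
    finally show ?thesis unfolding corresponding_def using V by auto
  qed
  show thesis
  proof (cases "cuts_in X U = {}")
    case True
    \<comment> \<open>If no cut lies in \<open>U\<close>, orient the image cut through the
      complement of \<open>U\<close> and pass back by complement.\<close>
    then obtain d where "d \<in> cuts_in X (topspace X - U)" using link_nonempty[OF X wide U] by blast
    then obtain V where "corresponding X Y \<Phi> (topspace X - U) V"
      using main[OF compl_sides[OF U]] by blast
    then show thesis
      using corresponding_compl[OF iso compl_sides[OF U]] compl_compl[OF U] that by metis
  next
    case False
    then show thesis using main[OF U] that by blast
  qed
qed

text \<open>If \<open>U\<close> were the complement of \<open>W\<close>, the two disjoint halves of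
  the link would coincide and hence both be empty, against \<open>link_nonempty\<close>.\<close>

lemma side_eq_if_same_cuts_in:
  assumes X: "stone_space X" and wide: "\<And>a b c d. \<not> topspace X \<subseteq> {a, b, c, d}"
    and "U \<in> sides X" "W \<in> sides X" "cut_of X U = cut_of X W" "cuts_in X U = cuts_in X W"
  shows "U = W"
  using cut_of_eq_iff[OF assms(3,4)] cuts_in_disjoint[OF assms(4)] link_nonempty[OF X wide assms(4)] assms(5,6)
  by auto

lemma cut_complex_iso_imp_side_iso:
  assumes X: "stone_space X" and Y: "stone_space Y"
    and wideX: "\<And>a b c d. \<not> topspace X \<subseteq> {a, b, c, d}" and wideY: "\<And>a b c d. \<not> topspace Y \<subseteq> {a, b, c, d}"
    and iso: "cut_complex_iso X Y \<Phi>"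
  obtains \<phi> where "\<phi> ` sides X = sides Y" "\<And>U. U \<in> sides X \<Longrightarrow> \<Phi> (cut_of X U) = cut_of Y (\<phi> U)"
    "\<And>U. U \<in> sides X \<Longrightarrow> \<phi> (topspace X - U) = topspace Y - \<phi> U"
    "\<And>U W. U \<in> sides X \<Longrightarrow> W \<in> sides X \<Longrightarrow> \<phi> U \<subseteq> \<phi> W \<longleftrightarrow> U \<subseteq> W"
proof -
  have inj: "inj_on \<Phi> (cut_vertices X)" and im: "\<Phi> ` cut_vertices X = cut_vertices Y"
    using iso unfolding cut_complex_iso_def bij_betw_def by blast+
  have "\<forall>U\<in>sides X. \<exists>V. corresponding X Y \<Phi> U V"
    using corresponding_exists[OF X Y wideX iso] by blast
  then obtain \<phi> where \<phi>: "\<And>U. U \<in> sides X \<Longrightarrow> corresponding X Y \<Phi> U (\<phi> U)"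
    by metis
  have \<phi>1: "\<phi> U \<in> sides Y" and \<phi>2: "cut_of Y (\<phi> U) = \<Phi> (cut_of X U)" and \<phi>3: "cuts_in Y (\<phi> U) = \<Phi> ` cuts_in X U"
    if "U \<in> sides X" for U
    using \<phi>[OF that] unfolding corresponding_def by auto
  have uniq: "V = \<phi> U" if "U \<in> sides X" "corresponding X Y \<Phi> U V" for U V
    using side_eq_if_same_cuts_in[OF Y wideY] \<phi>[OF that(1)] that(2) unfolding corresponding_def by metis
  have compl: "\<phi> (topspace X - U) = topspace Y - \<phi> U" if "U \<in> sides X" for U
    using uniq[OF compl_sides[OF that] corresponding_compl[OF iso that \<phi>[OF that]]] by simp
  have v: "cut_of X U \<in> cut_vertices X" if "U \<in> sides X" for U
    using that unfolding cut_vertices_eq by blast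
  have mem: "cut_of Y (\<phi> U) \<in> cuts_in Y (\<phi> W) \<longleftrightarrow> cut_of X U \<in> cuts_in X W"
    if "U \<in> sides X" "W \<in> sides X" for U W
    unfolding \<phi>2[OF that(1)] \<phi>3[OF that(2)]
    by (rule inj_on_image_mem_iff[OF inj v[OF that(1)] cuts_in_subset])
  have less: "\<phi> U \<subset> \<phi> W \<longleftrightarrow> U \<subset> W" if "U \<in> sides X" "W \<in> sides X" for U W
    unfolding psubset_iff_cuts_in[OF that] psubset_iff_cuts_in[OF \<phi>1[OF that(1)] \<phi>1[OF that(2)]]
    using mem that by simp
  have eq: "U = W" if U: "U \<in> sides X" and W: "W \<in> sides X" and e: "\<phi> U = \<phi> W" for U W
  proof -
    have "cut_of X U = cut_of X W"
      using \<phi>2[OF U] \<phi>2[OF W] e inj_onD[OF inj _ v[OF U] v[OF W]] by simp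
    moreover have "cuts_in X U = cuts_in X W"
      using \<phi>3[OF U] \<phi>3[OF W] e inj_on_image_eq_iff[OF inj cuts_in_subset cuts_in_subset] by simp
    ultimately show ?thesis using side_eq_if_same_cuts_in[OF X wideX U W] by blast
  qed
  have "\<phi> U \<subseteq> \<phi> W \<longleftrightarrow> U \<subseteq> W" if "U \<in> sides X" "W \<in> sides X" for U W
    using less[OF that] eq[OF that] unfolding subset_iff_psubset_eq by blast
  moreover have "\<phi> ` sides X = sides Y"
  proof (intro equalityI subsetI)
    fix V assume V: "V \<in> sides Y"
    have "cut_of Y V \<in> \<Phi> ` cut_vertices X"
      unfolding im cut_vertices_eq[of Y] using V by (rule imageI)
    then obtain U where U: "U \<in> sides X" "cut_of Y V = \<Phi> (cut_of X U)"
      unfolding cut_vertices_eq by auto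
    then have "cut_of Y V = cut_of Y (\<phi> U)" using \<phi>2 by simp
    \<comment> \<open>Surjectivity on cuts gives surjectivity on sides, since \<open>\<phi>\<close>
      reaches both orientations of the image cut.\<close>
    then have "V = \<phi> U \<or> V = \<phi> (topspace X - U)"
      using cut_of_eq_iff[OF V \<phi>1[OF U(1)]] compl[OF U(1)] by simp
    then show "V \<in> \<phi> ` sides X"
      using imageI[OF U(1), of \<phi>] imageI[OF compl_sides[OF U(1)], of \<phi>] by auto
  qed (use \<phi>1 in blast)
  ultimately show thesis using that[of \<phi>] compl \<phi>2[symmetric] by blast
qed


section \<open>Recovering points from sides\<close>

text \<open>Two further points \<open>z\<close> and \<open>w\<close> are put on the sides of
  \<open>x\<close> and \<open>y\<close> respectively, so that the separating clopen set and its
  complement each have two points.\<close>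

lemma sides_separate:
  assumes Z: "stone_space Z" and wide: "\<And>a b c d. \<not> topspace Z \<subseteq> {a, b, c, d}"
    and x: "x \<in> topspace Z" and y: "y \<in> topspace Z" and "x \<noteq> y"
  obtains V where "V \<in> sides Z" "x \<in> V" "y \<notin> V"
proof -
  obtain z where z: "z \<in> topspace Z" "z \<notin> {x, y, y, y}" using wide by blast
  obtain w where w: "w \<in> topspace Z" "w \<notin> {x, y, z, z}" using wide by blast
  have sep: "\<exists>K. clopenin Z K \<and> a \<in> K \<and> b \<notin> K" if "a \<in> topspace Z" "b \<in> topspace Z" "a \<noteq> b" for a b
    using stone_separation[OF Z that] by blast
  obtain K1 K2 K3 K4 where K: "clopenin Z K1" "x \<in> K1" "y \<notin> K1" "clopenin Z K2" "x \<in> K2" "w \<notin> K2"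
      "clopenin Z K3" "z \<in> K3" "y \<notin> K3" "clopenin Z K4" "z \<in> K4" "w \<notin> K4"
    using sep[OF x y \<open>x \<noteq> y\<close>] sep[OF x w(1)] sep[OF z(1) y] sep[OF z(1) w(1)] z(2) w(2) by auto
  let ?V = "K1 \<inter> K2 \<union> K3 \<inter> K4"
  have "clopenin Z ?V" using K by (simp add: openin_Un openin_Int closedin_Un closedin_Int)
  moreover have "many ?V" by (rule manyI[of x _ z]) (use K z in auto)
  moreover have "many (topspace Z - ?V)" by (rule manyI[of y _ w]) (use K w y in auto)
  ultimately show thesis using that[of ?V] K unfolding sides_def by simp
qed

text \<open>The graph is left behind: only an isomorphism of sides for inclusion and complement
  remains. Injectivity follows from \<open>le_iff\<close>, and the assumptions are symmetric, so
  that all results also apply to the inverse of \<open>\<phi>\<close>.\<close>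

locale side_iso =
  fixes X :: "'a topology" and Y :: "'b topology" and \<phi> :: "'a set \<Rightarrow> 'b set"
  assumes stoneX: "stone_space X" and stoneY: "stone_space Y"
    and wideX: "\<And>a b c d. \<not> topspace X \<subseteq> {a, b, c, d}" and wideY: "\<And>a b c d. \<not> topspace Y \<subseteq> {a, b, c, d}"
    and image: "\<phi> ` sides X = sides Y"
    and compl: "\<And>U. U \<in> sides X \<Longrightarrow> \<phi> (topspace X - U) = topspace Y - \<phi> U"
    and le_iff: "\<And>U W. U \<in> sides X \<Longrightarrow> W \<in> sides X \<Longrightarrow> \<phi> U \<subseteq> \<phi> W \<longleftrightarrow> U \<subseteq> W"
begin

lemma side: "U \<in> sides X \<Longrightarrow> \<phi> U \<in> sides Y"
  using image by blast

lemma inverse: "side_iso Y X (inv_into (sides X) \<phi>)"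
proof -
  have inj: "inj_on \<phi> (sides X)" using le_iff by (intro inj_onI) blast
  note f = f_inv_into_f[of _ \<phi> "sides X", unfolded image] and i = inv_into_into[of _ \<phi> "sides X", unfolded image]
  show ?thesis
  proof
    show "inv_into (sides X) \<phi> ` sides Y = sides X"
      unfolding image[symmetric] using inj by simp
    fix U assume U: "U \<in> sides Y"
    have "\<phi> (topspace X - inv_into (sides X) \<phi> U) = topspace Y - U"
      using compl[OF i[OF U]] f[OF U] by simp
    then show "inv_into (sides X) \<phi> (topspace Y - U) = topspace X - inv_into (sides X) \<phi> U"
      using inv_into_f_f[OF inj compl_sides[OF i[OF U]]] by simp
  next
    fix U W assume "U \<in> sides Y" "W \<in> sides Y"
    then show "inv_into (sides X) \<phi> U \<subseteq> inv_into (sides X) \<phi> W \<longleftrightarrow> U \<subseteq> W"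
      using le_iff[OF i i] f by metis
  qed (rule stoneX stoneY wideX wideY)+
qed

lemma inter_sides: "U \<in> sides Z \<Longrightarrow> W \<in> sides Z \<Longrightarrow> many (U \<inter> W) \<Longrightarrow> U \<inter> W \<in> sides Z"
  using many_mono[of "topspace Z - U" "topspace Z - (U \<inter> W)"] unfolding sides_def
  by (simp add: Diff_mono openin_Int closedin_Int)

lemma many_inter:
  assumes "U \<in> sides X" "W \<in> sides X" "many (\<phi> U \<inter> \<phi> W)"
  obtains T where "T \<in> sides X" "T \<subseteq> U \<inter> W" "\<phi> T = \<phi> U \<inter> \<phi> W"
proof -
  have "\<phi> U \<inter> \<phi> W \<in> \<phi> ` sides X"
    unfolding image by (rule inter_sides[OF side[OF assms(1)] side[OF assms(2)] assms(3)])
  then obtain T where T: "T \<in> sides X" "\<phi> U \<inter> \<phi> W = \<phi> T" by blast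
  have "T \<subseteq> U" "T \<subseteq> W" using T le_iff[OF T(1) assms(1)] le_iff[OF T(1) assms(2)] by blast+
  then show thesis using that T by simp
qed

text \<open>An intersection with at least two points is again a side, namely the largest one below
  both \<open>U\<close> and \<open>W\<close>, and an order isomorphism preserves greatest lower
  bounds.\<close>

lemma image_inter:
  assumes "U \<in> sides X" "W \<in> sides X" "many (U \<inter> W)"
  shows "\<phi> (U \<inter> W) = \<phi> U \<inter> \<phi> W"
proof -
  have Z: "U \<inter> W \<in> sides X" using inter_sides assms by blast
  have le: "\<phi> (U \<inter> W) \<subseteq> \<phi> U \<inter> \<phi> W" using le_iff[OF Z] assms(1,2) by simp
  have "many (\<phi> U \<inter> \<phi> W)" using many_mono[OF sidesD(6)[OF side[OF Z]] le] .
  then obtain T where T: "T \<in> sides X" "T \<subseteq> U \<inter> W" "\<phi> T = \<phi> U \<inter> \<phi> W"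
    using many_inter[OF assms(1,2)] by blast
  then show ?thesis using le le_iff[OF T(1) Z] by blast
qed

text \<open>Disjointness of two sides is inclusion in a complement, so it would pull back along
  \<open>\<phi>\<close> to \<open>U\<close> and \<open>W\<close>, which share
  \<open>x\<close>.\<close>

lemma image_meets:
  assumes "U \<in> sides X" "W \<in> sides X" "x \<in> U" "x \<in> W"
  shows "\<phi> U \<inter> \<phi> W \<noteq> {}"
proof
  assume "\<phi> U \<inter> \<phi> W = {}"
  then have "\<phi> W \<subseteq> \<phi> (topspace X - U)"
    using compl[OF assms(1)] sidesD(3)[OF side[OF assms(2)]] by blast
  then show False using le_iff[OF assms(2) compl_sides[OF assms(1)]] assms(3,4) by blast
qed

lemma un_sides: "U \<in> sides X \<Longrightarrow> clopenin X D \<Longrightarrow> many (topspace X - (U \<union> D)) \<Longrightarrow> U \<union> D \<in> sides X"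
  using many_mono[of U "U \<union> D"] unfolding sides_def by (simp add: openin_Un closedin_Un)

text \<open>\<open>A \<inter> B\<close> may be the single point \<open>x\<close>, about which \<open>\<phi>\<close> says nothing directly. Adding a piece
  \<open>D\<close> of \<open>C\<close> to both sets turns the intersection into a side contained in \<open>C\<close>.\<close>

lemma inter_subset_if_enlarged:
  assumes "A \<in> sides X" "B \<in> sides X" "C \<in> sides X" "x \<in> A" "x \<in> B" "A \<inter> B \<subseteq> C"
    and D: "clopenin X D" "d \<in> D" "x \<notin> D" "D \<subseteq> C"
    and "many (topspace X - (A \<union> D))" "many (topspace X - (B \<union> D))"
  shows "\<phi> A \<inter> \<phi> B \<subseteq> \<phi> C"
proof -
  have AD: "A \<union> D \<in> sides X" and BD: "B \<union> D \<in> sides X" using un_sides assms by blast+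
  have m: "many ((A \<union> D) \<inter> (B \<union> D))"
    by (rule manyI[of x _ d]) (use assms(4,5) D(2,3) in auto)
  have Z: "(A \<union> D) \<inter> (B \<union> D) \<in> sides X" using inter_sides[OF AD BD m] .
  have "\<phi> A \<subseteq> \<phi> (A \<union> D)" "\<phi> B \<subseteq> \<phi> (B \<union> D)"
    using le_iff[OF assms(1) AD] le_iff[OF assms(2) BD] by blast+
  moreover have "\<phi> (A \<union> D) \<inter> \<phi> (B \<union> D) = \<phi> ((A \<union> D) \<inter> (B \<union> D))"
    using image_inter[OF AD BD m] by simp
  moreover have "\<phi> ((A \<union> D) \<inter> (B \<union> D)) \<subseteq> \<phi> C"
    using le_iff[OF Z assms(3)] assms(6) D(4) by blast
  ultimately show ?thesis by blast
qed

text \<open>Since \<open>{x}\<close> is clopen, \<open>C - {x}\<close> splits into clopen pieces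
  separating \<open>c\<close> from \<open>c'\<close>. Adding only the piece of \<open>c\<close> to
  \<open>A\<close> and \<open>B\<close> leaves \<open>c'\<close> outside both, together with a point
  of \<open>B\<close> or \<open>A\<close>, so both remain sides.\<close>

lemma inter_subset_if_three_points:
  assumes A: "A \<in> sides X" and B: "B \<in> sides X" and C: "C \<in> sides X"
    and AB: "A \<inter> B = {x}" and AC: "A \<inter> C = {x}" and BC: "B \<inter> C = {x}"
    and c: "c \<in> C" "c' \<in> C" "c \<noteq> x" "c' \<noteq> x" "c \<noteq> c'"
  shows "\<phi> A \<inter> \<phi> B \<subseteq> \<phi> C"
proof -
  have "clopenin X {x}" using sidesD(1,2)[OF A] sidesD(1,2)[OF B] AB openin_Int[of X A B] closedin_Int[of X A B] by simp
  then have "clopenin X (C - {x})" using sidesD(1,2)[OF C] by (simp add: openin_diff closedin_diff)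
  then obtain D D' where D: "clopenin X D" "clopenin X D'" "c \<in> D" "c' \<in> D'" "D \<inter> D' = {}" "D \<union> D' = C - {x}"
    using split_clopen[OF stoneX, of "C - {x}" c c'] c by auto
  have DC: "D \<subseteq> C" "x \<notin> D" "c' \<notin> D" using D(4-6) by blast+
  obtain a where a: "a \<in> A" "a \<noteq> x" using sidesD(6)[OF A] unfolding many_def by blast
  obtain b where b: "b \<in> B" "b \<noteq> x" using sidesD(6)[OF B] unfolding many_def by blast
  have out: "a \<notin> B" "a \<notin> C" "b \<notin> A" "b \<notin> C" "c' \<notin> A" "c' \<notin> B" using AB AC BC a b c by blast+
  have top: "a \<in> topspace X" "b \<in> topspace X" "c' \<in> topspace X"
    using sidesD(3) A B C a b c by blast+
  have "many (topspace X - (A \<union> D))"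
    by (rule manyI[of b _ c']) (use out top DC c(2) in auto)
  moreover have "many (topspace X - (B \<union> D))"
    by (rule manyI[of a _ c']) (use out top DC c(2) in auto)
  ultimately show ?thesis
    using AB AC BC by (intro inter_subset_if_enlarged[OF A B C _ _ _ D(1,3) DC(2,1)]) blast+
qed

text \<open>If two of the sets share two points, their intersection is a side and
  \<open>image_meets\<close> applies. Otherwise all pairwise intersections are \<open>{x}\<close>,
  and some pair of images has its intersection inside the third image.\<close>

lemma triple_meets:
  assumes A: "A \<in> sides X" "x \<in> A" and B: "B \<in> sides X" "x \<in> B" and C: "C \<in> sides X" "x \<in> C"
  shows "\<phi> A \<inter> \<phi> B \<inter> \<phi> C \<noteq> {}"
proof -
  have big: "\<phi> U \<inter> \<phi> V \<inter> \<phi> W \<noteq> {}"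
    if "U \<in> sides X" "V \<in> sides X" "W \<in> sides X" "x \<in> U" "x \<in> V" "x \<in> W" "many (U \<inter> V)" for U V W
    using image_inter[OF that(1,2,7)] image_meets[OF inter_sides[OF that(1,2,7)] that(3), of x] that(4-6) by simp
  show ?thesis
  proof (cases "many (A \<inter> B) \<or> many (A \<inter> C) \<or> many (B \<inter> C)")
    case True
    then show ?thesis
      using big[of A B C] big[of A C B] big[of B C A] assms by (auto simp: Int_ac)
  next
    case False
    have single: "S = {x}" if "x \<in> S" "\<not> many S" for S using that unfolding many_def by blast
    have AB: "A \<inter> B = {x}" and AC: "A \<inter> C = {x}" and BC: "B \<inter> C = {x}"
      using False assms by (auto intro!: single)
    obtain a where a: "a \<in> A" "a \<noteq> x" using sidesD(6)[OF A(1)] unfolding many_def by blast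
    obtain b where b: "b \<in> B" "b \<noteq> x" using sidesD(6)[OF B(1)] unfolding many_def by blast
    obtain c where c: "c \<in> C" "c \<noteq> x" using sidesD(6)[OF C(1)] unfolding many_def by blast
    have "\<phi> A \<inter> \<phi> B \<subseteq> \<phi> C \<or> \<phi> A \<inter> \<phi> C \<subseteq> \<phi> B \<or> \<phi> B \<inter> \<phi> C \<subseteq> \<phi> A"
    proof (rule ccontr)
      assume neg: "\<not> ?thesis"
      have C': "C \<subseteq> {x, c}"
        using inter_subset_if_three_points[OF A(1) B(1) C(1) AB AC BC c(1) _ c(2)] neg by blast
      have B': "B \<subseteq> {x, b}"
        using inter_subset_if_three_points[OF A(1) C(1) B(1) AC AB _ b(1) _ b(2)] BC neg by blast
      have A': "A \<subseteq> {x, a}"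
        using inter_subset_if_three_points[OF B(1) C(1) A(1) BC _ _ a(1) _ a(2)] AB AC neg by blast
      \<comment> \<open>All three sets now have two points. The fifth point \<open>p\<close> takes
        over the part of \<open>c'\<close>, and all of \<open>C - {x}\<close> can be added to
        \<open>A\<close> and \<open>B\<close>.\<close>
      obtain p where p: "p \<in> topspace X" "p \<notin> {x, a, b, c}" using wideX by blast
      have "clopenin X {x}"
        using sidesD(1,2)[OF A(1)] sidesD(1,2)[OF B(1)] AB openin_Int[of X A B] closedin_Int[of X A B] by simp
      then have D: "clopenin X (C - {x})" using sidesD(1,2)[OF C(1)] by (simp add: openin_diff closedin_diff)
      have out: "a \<notin> B" "a \<notin> C" "b \<notin> A" "b \<notin> C" "p \<notin> A" "p \<notin> B" "p \<notin> C" "p \<noteq> a" "p \<noteq> b"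
        using AB AC BC a b p(2) subsetD[OF A', of p] subsetD[OF B', of p] subsetD[OF C', of p] by auto
      have top: "a \<in> topspace X" "b \<in> topspace X" using sidesD(3) A(1) B(1) a b by blast+
      have "many (topspace X - (A \<union> (C - {x})))"
        by (rule manyI[of b _ p]) (use out top p(1) in auto)
      moreover have "many (topspace X - (B \<union> (C - {x})))"
        by (rule manyI[of a _ p]) (use out top p(1) in auto)
      ultimately have "\<phi> A \<inter> \<phi> B \<subseteq> \<phi> C"
        using AB assms(2,4,6) c by (intro inter_subset_if_enlarged[OF A(1) B(1) C(1) _ _ _ D, of x c]) auto
      then show False using neg by blast
    qed
    then show ?thesis
      using image_meets[of A B x] image_meets[of A C x] image_meets[of B C x] assms by blast
  qed
qed

section \<open>The point map and its continuity\<close>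

lemma point_exists:
  assumes "x \<in> topspace X"
  obtains y where "y \<in> topspace Y" "\<And>U. U \<in> sides X \<Longrightarrow> x \<in> U \<Longrightarrow> y \<in> \<phi> U"
proof (cases "\<exists>A\<in>sides X. \<exists>B\<in>sides X. x \<in> A \<and> x \<in> B \<and> \<not> many (A \<inter> B)")
  case True
  then obtain A B where AB: "A \<in> sides X" "B \<in> sides X" "x \<in> A" "x \<in> B" "\<not> many (A \<inter> B)" by blast
  obtain y where y: "y \<in> \<phi> A" "y \<in> \<phi> B" using image_meets[OF AB(1-4)] by blast
  \<comment> \<open>Otherwise this intersection would be the image of a side contained in
    \<open>A \<inter> B\<close>, which is too small. So \<open>y\<close> is its only point, and
    \<open>triple_meets\<close> puts it in every other image.\<close>
  have "\<not> many (\<phi> A \<inter> \<phi> B)"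
    using many_inter[OF AB(1,2)] AB(5) sidesD(6) many_mono by metis
  then have only: "z = y" if "z \<in> \<phi> A" "z \<in> \<phi> B" for z using that y unfolding many_def by blast
  show thesis
  proof (rule that)
    show "y \<in> topspace Y" using y(1) sidesD(3)[OF side[OF AB(1)]] by blast
    fix U assume U: "U \<in> sides X" "x \<in> U"
    then obtain z where z: "z \<in> \<phi> A" "z \<in> \<phi> B" "z \<in> \<phi> U"
      using triple_meets[OF AB(1,3) AB(2,4) U] by blast
    then show "y \<in> \<phi> U" using only[OF z(1,2)] by simp
  qed
next
  case False
  let ?N = "{U \<in> sides X. x \<in> U}"
  \<comment> \<open>The sides around \<open>x\<close> are now closed under binary intersection, so
    finitely many images always contain the image of one side.\<close>
  have fin: "G = {} \<or> (\<exists>Z\<in>?N. \<forall>U\<in>G. \<phi> Z \<subseteq> \<phi> U)" if "finite G" "G \<subseteq> ?N" for G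
    using that
  proof (induction G rule: finite_induct)
    case (insert U G)
    then consider "G = {}" | Z where "Z \<in> ?N" "\<forall>U\<in>G. \<phi> Z \<subseteq> \<phi> U" by blast
    then show ?case
    proof cases
      case 1
      then show ?thesis using insert.prems by blast
    next
      case 2
      then have m: "many (Z \<inter> U)" using False insert.prems by blast
      then have "\<phi> (Z \<inter> U) = \<phi> Z \<inter> \<phi> U" "Z \<inter> U \<in> ?N"
        using image_inter[of Z U] inter_sides[of Z X U] 2(1) insert.prems by auto
      then show ?thesis using 2(2) by (intro disjI2 bexI[of _ "Z \<inter> U"]) auto
    qed
  qed simp
  \<comment> \<open>Inserting \<open>topspace Y\<close> guarantees that the point found by
    compactness lies in the space.\<close>
  have "\<Inter> (insert (topspace Y) (\<phi> ` ?N)) \<noteq> {}"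
  proof (rule compact_space_fip[THEN iffD1, rule_format])
    show "compact_space Y" using stoneY unfolding stone_space_def by blast
  next
    show "(\<forall>C\<in>insert (topspace Y) (\<phi> ` ?N). closedin Y C) \<and>
      (\<forall>F. finite F \<and> F \<subseteq> insert (topspace Y) (\<phi> ` ?N) \<longrightarrow> \<Inter> F \<noteq> {})"
    proof (intro conjI allI impI)
      show "\<forall>C\<in>insert (topspace Y) (\<phi> ` ?N). closedin Y C" using side sidesD(2) by auto
      fix F assume F: "finite F \<and> F \<subseteq> insert (topspace Y) (\<phi> ` ?N)"
      then have "finite (F - {topspace Y})" "F - {topspace Y} \<subseteq> \<phi> ` ?N" by blast+
      then obtain G where G: "G \<subseteq> ?N" "finite G" "F - {topspace Y} = \<phi> ` G"
        by (meson finite_subset_image)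
      have "\<exists>y\<in>topspace Y. \<forall>U\<in>G. y \<in> \<phi> U"
      proof (cases "G = {}")
        case True
        then show ?thesis using wideY by blast
      next
        case False
        then obtain Z where Z: "Z \<in> ?N" "\<forall>U\<in>G. \<phi> Z \<subseteq> \<phi> U" using fin[OF G(2,1)] by blast
        then have "\<phi> Z \<in> sides Y" using side by blast
        then obtain y where "y \<in> \<phi> Z" "y \<in> topspace Y" using sidesD(3,4) by blast
        then show ?thesis using Z by blast
      qed
      then obtain y where y: "y \<in> topspace Y" "\<And>U. U \<in> G \<Longrightarrow> y \<in> \<phi> U" by blast
      have "y \<in> C" if "C \<in> F" for C
        using that y G(3) by (cases "C = topspace Y") auto
      then show "\<Inter> F \<noteq> {}" by blast
    qed
  qed
  then obtain y where y: "y \<in> topspace Y" "\<And>U. U \<in> ?N \<Longrightarrow> y \<in> \<phi> U" by auto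
  show thesis by (rule that[OF y(1)]) (use y(2) in blast)
qed

definition point :: "'a \<Rightarrow> 'b" where
  "point x = (SOME y. y \<in> topspace Y \<and> (\<forall>U\<in>sides X. x \<in> U \<longrightarrow> y \<in> \<phi> U))"

text \<open>The converse implication comes from the complement: if \<open>x\<close> is not in
  \<open>U\<close>, then \<open>point x\<close> lies in the image of \<open>topspace X - U\<close>,
  which is disjoint from that of \<open>U\<close>.\<close>

lemma point:
  assumes "x \<in> topspace X"
  shows "point x \<in> topspace Y" "U \<in> sides X \<Longrightarrow> point x \<in> \<phi> U \<longleftrightarrow> x \<in> U"
proof -
  have "\<exists>y. y \<in> topspace Y \<and> (\<forall>U\<in>sides X. x \<in> U \<longrightarrow> y \<in> \<phi> U)"
    using point_exists[OF assms] by metis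
  from someI_ex[OF this] have p: "point x \<in> topspace Y" "\<And>U. U \<in> sides X \<Longrightarrow> x \<in> U \<Longrightarrow> point x \<in> \<phi> U"
    unfolding point_def by blast+
  show "point x \<in> topspace Y" by (rule p)
  assume U: "U \<in> sides X"
  show "point x \<in> \<phi> U \<longleftrightarrow> x \<in> U"
    using p(2)[OF U] p(2)[OF compl_sides[OF U]] compl[OF U] assms by blast
qed

lemma continuous_point: "continuous_map X Y point"
  unfolding continuous_map_def
proof (intro conjI allI impI)
  show "point \<in> topspace X \<rightarrow> topspace Y" using point(1) by blast
  fix W assume W: "openin Y W"
  show "openin X {x \<in> topspace X. point x \<in> W}"
    unfolding openin_subopen[of _ "{x \<in> topspace X. point x \<in> W}"]
  proof
    fix x assume "x \<in> {x \<in> topspace X. point x \<in> W}"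
    then have x: "x \<in> topspace X" "point x \<in> W" by auto
    let ?N = "{U \<in> sides X. x \<in> U}"
    have "compactin Y (topspace Y - W)"
      using W stoneY unfolding stone_space_def by (intro closedin_compact_space) auto
    moreover have "openin Y V" if "V \<in> (\<lambda>U. topspace Y - \<phi> U) ` ?N" for V
      using that side sidesD(2) by blast
    \<comment> \<open>Each point outside \<open>W\<close> is separated from \<open>point x\<close>
      by a side, so the complements of the images of sides around \<open>x\<close> cover it. A
      finite subcover then yields a neighbourhood of \<open>x\<close> mapped into
      \<open>W\<close>.\<close>
    moreover have "topspace Y - W \<subseteq> \<Union> ((\<lambda>U. topspace Y - \<phi> U) ` ?N)"
    proof
      fix y assume y: "y \<in> topspace Y - W"
      then have "point x \<noteq> y" using x by blast
      then obtain V where V: "V \<in> sides Y" "point x \<in> V" "y \<notin> V"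
        using sides_separate[OF stoneY wideY point(1)[OF x(1)]] y by blast
      then obtain U where U: "U \<in> sides X" "V = \<phi> U" using image by blast
      then have "x \<in> U" using V(2) point(2)[OF x(1) U(1)] by simp
      then show "y \<in> \<Union> ((\<lambda>U. topspace Y - \<phi> U) ` ?N)" using U V(3) y by blast
    qed
    ultimately obtain \<F> where F: "finite \<F>" "\<F> \<subseteq> (\<lambda>U. topspace Y - \<phi> U) ` ?N" "topspace Y - W \<subseteq> \<Union> \<F>"
      using compactinD[of Y "topspace Y - W" "(\<lambda>U. topspace Y - \<phi> U) ` ?N"] by meson
    then obtain G where G: "G \<subseteq> ?N" "finite G" "\<F> = (\<lambda>U. topspace Y - \<phi> U) ` G"
      by (meson finite_subset_image)
    let ?T = "topspace X \<inter> \<Inter> G"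
    have "openin X ?T"
      using G(1,2) sidesD(1) by (cases "G = {}") (auto intro!: openin_Int openin_Inter)
    moreover have "x \<in> ?T" using x G(1) by blast
    moreover have "point z \<in> W" if z: "z \<in> ?T" for z
    proof (rule ccontr)
      assume "point z \<notin> W"
      then have "point z \<in> \<Union> \<F>" using F(3) point(1)[of z] z by blast
      then obtain U where U: "U \<in> G" "point z \<notin> \<phi> U" unfolding G(3) by blast
      then have "U \<in> sides X" "z \<in> U" using z G(1) by blast+
      then show False using U(2) point(2)[of z U] z by blast
    qed
    ultimately show "\<exists>T. openin X T \<and> x \<in> T \<and> T \<subseteq> {x \<in> topspace X. point x \<in> W}" by blast
  qed
qed

end

text \<open>The point map of the inverse isomorphism is the inverse: a point and its image under the
  round trip lie in the same sides, and sides separate points.\<close>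

lemma (in side_iso) homeomorphism_exists:
  obtains f where "homeomorphic_map X Y f" "\<And>U. U \<in> sides X \<Longrightarrow> f ` U = \<phi> U"
proof -
  interpret inv: side_iso Y X "inv_into (sides X) \<phi>" by (rule inverse)
  have inj: "inj_on \<phi> (sides X)" using le_iff by (intro inj_onI) blast
  have inv_point: "inv.point y \<in> U \<longleftrightarrow> y \<in> \<phi> U" if "y \<in> topspace Y" "U \<in> sides X" for y U
    using inv.point(2)[OF that(1) side[OF that(2)]] inv_into_f_f[OF inj that(2)] by simp
  have gf: "inv.point (point x) = x" if x: "x \<in> topspace X" for x
  proof (rule ccontr)
    assume "inv.point (point x) \<noteq> x"
    then obtain U where "U \<in> sides X" "inv.point (point x) \<in> U" "x \<notin> U"
      using sides_separate[OF stoneX wideX inv.point(1)[OF point(1)[OF x]] x] by blast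
    then show False using inv_point[OF point(1)[OF x]] point(2)[OF x] by blast
  qed
  have fg: "point (inv.point y) = y" if y: "y \<in> topspace Y" for y
  proof (rule ccontr)
    assume "point (inv.point y) \<noteq> y"
    then obtain V where V: "V \<in> sides Y" "point (inv.point y) \<in> V" "y \<notin> V"
      using sides_separate[OF stoneY wideY point(1)[OF inv.point(1)[OF y]] y] by blast
    then obtain U where "U \<in> sides X" "V = \<phi> U" using image by blast
    then show False using V(2,3) inv_point[OF y] point(2)[OF inv.point(1)[OF y]] by blast
  qed
  have "homeomorphic_maps X Y point inv.point"
    unfolding homeomorphic_maps_def using continuous_point inv.continuous_point gf fg by blast
  then have "homeomorphic_map X Y point" unfolding homeomorphic_map_maps by blast
  moreover have "point ` U = \<phi> U" if U: "U \<in> sides X" for U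
  proof (intro equalityI subsetI)
    fix y assume y: "y \<in> \<phi> U"
    then have "y \<in> topspace Y" using sidesD(3)[OF side[OF U]] by blast
    then show "y \<in> point ` U" using inv_point[OF _ U] y fg by (intro image_eqI[of _ _ "inv.point y"]) auto
  next
    fix y assume "y \<in> point ` U"
    then show "y \<in> \<phi> U" using point(2)[OF _ U] sidesD(3)[OF U] by blast
  qed
  ultimately show thesis by (rule that)
qed


section \<open>Four points and the theorem\<close>

lemma wide_iff_adj:
  assumes Z: "stone_space Z" "topspace Z \<noteq> {}"
  shows "(\<forall>a b c d. \<not> topspace Z \<subseteq> {a, b, c, d}) \<longleftrightarrow> (\<exists>c d. cut_adj Z c d)"
proof
  assume wide: "\<forall>a b c d. \<not> topspace Z \<subseteq> {a, b, c, d}"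
  obtain x where x: "x \<in> topspace Z" using Z(2) by blast
  obtain y where y: "y \<in> topspace Z" "x \<noteq> y" using wide[rule_format, of x x x x] by blast
  obtain V where V: "V \<in> sides Z"
    using sides_separate[OF Z(1) _ x y] wide by metis
  then obtain d where "d \<in> cuts_in Z V \<union> cuts_in Z (topspace Z - V)"
    using link_nonempty[OF Z(1) _ V] wide by blast
  then show "\<exists>c d. cut_adj Z c d" using link_eq[OF V] by blast
next
  assume "\<exists>c d. cut_adj Z c d"
  then obtain A B where AB: "A \<in> sides Z" "B \<in> sides Z" "cut_adj Z (cut_of Z A) (cut_of Z B)"
    using cut_adjD[of Z] unfolding cut_vertices_eq by blast
  \<comment> \<open>Up to complements an edge is a strict inclusion. Two points in \<open>P\<close>,
    one in \<open>Q - P\<close> and two outside \<open>Q\<close> make five.\<close>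
  then obtain P Q where PQ: "P \<in> sides Z" "Q \<in> sides Z" "P \<subset> Q"
    using cut_adj_cut_of_iff[OF AB(1,2)] compl_sides by metis
  obtain p p' where p: "p \<in> P" "p' \<in> P" "p \<noteq> p'" using sidesD(6)[OF PQ(1)] unfolding many_def by blast
  obtain r r' where r: "r \<in> topspace Z - Q" "r' \<in> topspace Z - Q" "r \<noteq> r'"
    using sidesD(7)[OF PQ(2)] unfolding many_def by blast
  obtain q where q: "q \<in> Q" "q \<notin> P" using PQ(3) by blast
  have "distinct [p, p', q, r, r']" using p q r PQ(3) by auto
  then have five: "card {p, p', q, r, r'} = 5" by simp
  have sub: "{p, p', q, r, r'} \<subseteq> topspace Z" using p q r PQ(3) sidesD(3)[OF PQ(2)] by auto
  have "\<not> topspace Z \<subseteq> {a, b, c, d}" for a b c d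
  proof
    assume "topspace Z \<subseteq> {a, b, c, d}"
    then have "card {p, p', q, r, r'} \<le> card (set [a, b, c, d])"
      using sub by (intro card_mono) auto
    also have "\<dots> \<le> 4" using card_length[of "[a, b, c, d]"] by simp
    finally show False using five by simp
  qed
  then show "\<forall>a b c d. \<not> topspace Z \<subseteq> {a, b, c, d}" by blast
qed

lemma openin_if_finite_stone:
  assumes "stone_space Z" "finite (topspace Z)" "S \<subseteq> topspace Z"
  shows "openin Z S"
proof -
  have "t1_space Z" using assms(1) unfolding stone_space_def by (simp add: Hausdorff_imp_t1_space)
  then have "closedin Z (topspace Z - S)"
    using assms(2) by (simp add: t1_space_closedin_finite)
  then show ?thesis using assms(3) by (simp add: openin_closedin)
qed

text \<open>Up to complement the side contains \<open>a\<close>. It contains another point and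
  misses two, so it is a pair.\<close>

lemma sides_of_four_points:
  assumes Z: "topspace Z = {a, b, c, d}" and dist: "distinct [a, b, c, d]" and U: "U \<in> sides Z"
  shows "cut_of Z U \<in> cut_of Z ` {{a, b}, {a, c}, {a, d}}"
proof -
  have main: "V \<in> {{a, b}, {a, c}, {a, d}}" if V: "V \<in> sides Z" and a: "a \<in> V" for V
  proof -
    have sub: "V \<subseteq> {a, b, c, d}" using sidesD(3)[OF V] Z by simp
    obtain p where p: "p \<in> V" "p \<noteq> a" using sidesD(6)[OF V] unfolding many_def by blast
    obtain q q' where q: "q \<in> topspace Z - V" "q' \<in> topspace Z - V" "q \<noteq> q'"
      using sidesD(7)[OF V] unfolding many_def by blast
    have pq: "p \<in> {b, c, d}" "q \<in> {b, c, d}" "q' \<in> {b, c, d}" "p \<noteq> q" "p \<noteq> q'"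
      using p q sub a Z by auto
    then have "V - {a} \<subseteq> {p}" using sub q by auto
    then have "V = {a, p}" using p a by blast
    then show ?thesis using pq(1) by blast
  qed
  show ?thesis
  proof (cases "a \<in> U")
    case True
    then show ?thesis using main[OF U] by blast
  next
    case False
    then have "topspace Z - U \<in> {{a, b}, {a, c}, {a, d}}" using main[OF compl_sides[OF U]] Z by blast
    then show ?thesis using cut_of_compl[OF U] by (metis imageI)
  qed
qed

text \<open>In \<open>Y\<close> distinct cuts cross, so the images of the cuts of
  \<open>{a, b}\<close> and \<open>{a, c}\<close> have four nonempty corners. These are single
  points that label \<open>Y\<close>, and \<open>f\<close> respects the labels.\<close>

lemma four_points_case:
  assumes X: "stone_space X" "card (topspace X) = 4" and Y: "stone_space Y" "card (topspace Y) = 4"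
    and iso: "cut_complex_iso X Y \<Phi>" and no_adj: "\<And>c d. \<not> cut_adj Y c d"
  obtains f where "homeomorphic_map X Y f"
    "\<And>U. U \<in> sides X \<Longrightarrow> \<Phi> (cut_of X U) = cut_of Y (f ` U)"
proof -
  have inj: "inj_on \<Phi> (cut_vertices X)" and im: "\<Phi> ` cut_vertices X = cut_vertices Y"
    using iso unfolding cut_complex_iso_def bij_betw_def by blast+
  have fin: "finite (topspace X)" "finite (topspace Y)" using X Y by (auto intro: card_ge_0_finite)
  then obtain xs where xs: "set xs = topspace X" "distinct xs" using finite_distinct_list by blast
  then have "length xs = 4" using X(2) distinct_card by metis
  then obtain a b c d where abcd: "xs = [a, b, c, d]"
    by (auto simp: numeral_eq_Suc length_Suc_conv)
  then have tX: "topspace X = {a, b, c, d}" and dist: "distinct [a, b, c, d]" using xs by auto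
  have pair: "{a, u} \<in> sides X" if u: "u \<in> {b, c, d}" for u
  proof -
    obtain v w where vw: "v \<in> {b, c, d}" "w \<in> {b, c, d}" "v \<noteq> w" "v \<noteq> u" "w \<noteq> u"
      using u dist by auto
    have "many {a, u}" using u dist by (intro manyI[of a _ u]) auto
    moreover have "many (topspace X - {a, u})" using vw dist tX by (intro manyI[of v _ w]) auto
    moreover have "{a, u} \<subseteq> topspace X" using u tX by auto
    then have "openin X {a, u}" "closedin X {a, u}"
      unfolding closedin_def using openin_if_finite_stone[OF X(1) fin(1)] by blast+
    ultimately show ?thesis unfolding sides_def by simp
  qed
  have Xsub: "{a, u} \<subseteq> topspace X" if "u \<in> {b, c, d}" for u using sidesD(3)[OF pair[OF that]] .
  have cneq: "cut_of X {a, u} \<noteq> cut_of X {a, v}" if "u \<in> {b, c, d}" "v \<in> {b, c, d}" "u \<noteq> v" for u v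
  proof -
    have "u \<notin> {a, v}" using that dist by auto
    then have "{a, u} \<noteq> {a, v}" "{a, u} \<noteq> topspace X - {a, v}" by blast+
    then show ?thesis using cut_of_eq_iff[OF pair[OF that(1)] pair[OF that(2)]] by blast
  qed
  have v: "cut_of X {a, u} \<in> cut_vertices X" if "u \<in> {b, c, d}" for u
    using pair[OF that] unfolding cut_vertices_eq by blast
  have \<Phi>neq: "\<Phi> (cut_of X {a, u}) \<noteq> \<Phi> (cut_of X {a, v})" if "u \<in> {b, c, d}" "v \<in> {b, c, d}" "u \<noteq> v" for u v
    using inj_onD[OF inj _ v[OF that(1)] v[OF that(2)]] cneq[OF that] by blast
  have "\<exists>A\<in>sides Y. \<Phi> (cut_of X {a, u}) = cut_of Y A" if "u \<in> {b, c, d}" for u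
    using imageI[OF v[OF that], of \<Phi>] unfolding im cut_vertices_eq[of Y] by blast
  then obtain A B where A: "A \<in> sides Y" "\<Phi> (cut_of X {a, b}) = cut_of Y A"
    and B: "B \<in> sides Y" "\<Phi> (cut_of X {a, c}) = cut_of Y B" by (meson insertI1 insertI2)
  have "cut_of Y A \<noteq> cut_of Y B" using \<Phi>neq[of b c] A B dist by simp
  then have "cuts_cross (cut_of Y A) (cut_of Y B)"
    using no_adj[of "cut_of Y A" "cut_of Y B"] A(1) B(1) unfolding cut_adj_def cut_vertices_eq by blast
  then have "A \<inter> B \<noteq> {}" "A \<inter> (topspace Y - B) \<noteq> {}" "(topspace Y - A) \<inter> B \<noteq> {}"
      "(topspace Y - A) \<inter> (topspace Y - B) \<noteq> {}"
    unfolding cuts_cross_def cut_of_def by blast+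
  then obtain a' b' c' d' where pts: "a' \<in> A" "a' \<in> B" "b' \<in> A" "b' \<in> topspace Y" "b' \<notin> B"
      "c' \<in> topspace Y" "c' \<notin> A" "c' \<in> B" "d' \<in> topspace Y" "d' \<notin> A" "d' \<notin> B" by blast
  have dist': "distinct [a', b', c', d']" using pts by auto
  have "{a', b', c', d'} \<subseteq> topspace Y" using pts sidesD(3)[OF A(1)] by blast
  moreover have "card {a', b', c', d'} = card (topspace Y)" using dist' Y(2) by simp
  ultimately have tY: "topspace Y = {a', b', c', d'}" using card_subset_eq[OF fin(2)] by metis
  have Aeq: "A = {a', b'}" and Beq: "B = {a', c'}"
    using pts sidesD(3)[OF A(1)] sidesD(3)[OF B(1)] tY by auto
  \<comment> \<open>The values follow the corners: \<open>b'\<close> lies in \<open>A\<close> only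
    and \<open>c'\<close> in \<open>B\<close> only. The default \<open>d'\<close> serves for
    \<open>d\<close>.\<close>
  define f where "f = (\<lambda>x. if x = a then a' else if x = b then b' else if x = c then c' else d')"
  have f: "f a = a'" "f b = b'" "f c = c'" "f d = d'" using dist unfolding f_def by auto
  have fX: "f ` topspace X = topspace Y" unfolding tX tY using f by auto
  have finj: "inj_on f (topspace X)" unfolding tX using f dist' by (auto simp: inj_on_def)
  have "continuous_map X Y f"
    unfolding continuous_map_def using fX by (intro conjI allI impI openin_if_finite_stone[OF X(1) fin(1)]) auto
  then have homeo: "homeomorphic_map X Y f"
    using continuous_imp_homeomorphic_map[OF _ _ _ fX finj] X(1) Y(1) unfolding stone_space_def by blast
  have fcompl: "cut_of Y (f ` U) = (`) f ` cut_of X U" if "U \<subseteq> topspace X" for U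
  proof -
    have "f ` (topspace X - U) = topspace Y - f ` U"
      using inj_on_image_set_diff[OF finj Diff_subset that] fX by simp
    then show ?thesis unfolding cut_of_def by simp
  qed
  have b: "\<Phi> (cut_of X {a, b}) = cut_of Y (f ` {a, b})" and c: "\<Phi> (cut_of X {a, c}) = cut_of Y (f ` {a, c})"
    using A(2) B(2) Aeq Beq f by simp_all
  have "\<Phi> (cut_of X {a, d}) \<in> cut_of Y ` sides Y"
    using imageI[OF v[of d], of \<Phi>] unfolding im cut_vertices_eq[of Y] by blast
  then have "\<Phi> (cut_of X {a, d}) \<in> cut_of Y ` {{a', b'}, {a', c'}, {a', d'}}"
    using sides_of_four_points[OF tY dist'] by auto
  \<comment> \<open>Only three cuts are possible in \<open>Y\<close>, and injectivity of
    \<open>\<Phi>\<close> excludes the two already taken.\<close>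
  then have d: "\<Phi> (cut_of X {a, d}) = cut_of Y (f ` {a, d})"
    using \<Phi>neq[of d b] \<Phi>neq[of d c] b c f dist by auto
  have "\<Phi> (cut_of X U) = cut_of Y (f ` U)" if U: "U \<in> sides X" for U
  proof -
    obtain u where u: "u \<in> {b, c, d}" "cut_of X U = cut_of X {a, u}"
      using sides_of_four_points[OF tX dist U] by blast
    have "\<Phi> (cut_of X {a, u}) = cut_of Y (f ` {a, u})" using u(1) b c d by blast
    also have "\<dots> = cut_of Y (f ` U)"
      unfolding fcompl[OF Xsub[OF u(1)]] fcompl[OF sidesD(3)[OF U]] u(2) ..
    finally show ?thesis using u(2) by simp
  qed
  then show thesis using that homeo by blast
qed

theorem mainTheorem12:
  fixes X :: "'a topology" and Y :: "'b topology" and \<Phi> :: "'a set set \<Rightarrow> 'b set set"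
  assumes "stone_space X" and "second_countable X"
    and "stone_space Y" and "second_countable Y"
    and "infinite (topspace X) \<or> card (topspace X) \<ge> 4"
    and "infinite (topspace Y) \<or> card (topspace Y) \<ge> 4"
    and "cut_complex_iso X Y \<Phi>"
  shows "\<exists>f. homeomorphic_map X Y f \<and>
           (\<forall>U V. nonperipheral_cut X {U, V} \<longrightarrow> \<Phi> {U, V} = {f ` U, f ` V})"
proof -
  note X = assms(1) and Y = assms(3) and iso = assms(7)
  have ne: "topspace X \<noteq> {}" "topspace Y \<noteq> {}" using assms(5,6) by auto
  have four: "card (topspace Z) = 4"
    if "infinite (topspace Z) \<or> card (topspace Z) \<ge> 4" "topspace Z \<subseteq> {a, b, c, d}" for Z :: "'c topology" and a b c d
  proof -
    have "finite (topspace Z)" using that(2) by (rule finite_subset) simp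
    moreover have "card (topspace Z) \<le> card (set [a, b, c, d])" using that(2) by (intro card_mono) auto
    moreover have "card (set [a, b, c, d]) \<le> 4" using card_length[of "[a, b, c, d]"] by simp
    ultimately show ?thesis using that(1) by simp
  qed
  have adj: "(\<exists>c d. cut_adj Y c d) \<longleftrightarrow> (\<exists>c d. cut_adj X c d)"
  proof
    assume "\<exists>c d. cut_adj X c d"
    then obtain c d where "cut_adj X c d" by blast
    then have "cut_adj Y (\<Phi> c) (\<Phi> d)" using iso cut_adjD[of X c d] unfolding cut_complex_iso_def by blast
    then show "\<exists>c d. cut_adj Y c d" by blast
  next
    assume "\<exists>c d. cut_adj Y c d"
    then obtain c' d' where cd': "cut_adj Y c' d'" by blast
    have "\<Phi> ` cut_vertices X = cut_vertices Y"
      using iso unfolding cut_complex_iso_def bij_betw_def by blast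
    then obtain c d where cd: "c \<in> cut_vertices X" "d \<in> cut_vertices X" "c' = \<Phi> c" "d' = \<Phi> d"
      using cut_adjD[OF cd'] by (metis imageE)
    then have "cut_adj X c d" using iso cd' unfolding cut_complex_iso_def by simp
    then show "\<exists>c d. cut_adj X c d" by blast
  qed
  have "\<exists>f. homeomorphic_map X Y f \<and> (\<forall>U\<in>sides X. \<Phi> (cut_of X U) = cut_of Y (f ` U))"
  \<comment> \<open>Having an edge is invariant under \<open>\<Phi>\<close>, so both spaces have at
    least five points or both have exactly four.\<close>
  proof (cases "\<exists>c d. cut_adj X c d")
    case True
    then have wideX: "\<And>a b c d. \<not> topspace X \<subseteq> {a, b, c, d}" and wideY: "\<And>a b c d. \<not> topspace Y \<subseteq> {a, b, c, d}"
      using wide_iff_adj[OF X ne(1)] wide_iff_adj[OF Y ne(2)] adj by simp_all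
    obtain \<phi> where \<phi>: "\<phi> ` sides X = sides Y" "\<And>U. U \<in> sides X \<Longrightarrow> \<Phi> (cut_of X U) = cut_of Y (\<phi> U)"
        "\<And>U. U \<in> sides X \<Longrightarrow> \<phi> (topspace X - U) = topspace Y - \<phi> U"
        "\<And>U W. U \<in> sides X \<Longrightarrow> W \<in> sides X \<Longrightarrow> \<phi> U \<subseteq> \<phi> W \<longleftrightarrow> U \<subseteq> W"
      using cut_complex_iso_imp_side_iso[OF X Y wideX wideY iso] by metis
    interpret side_iso X Y \<phi>
      by unfold_locales (fact X Y wideX wideY \<phi>)+
    show ?thesis using homeomorphism_exists \<phi>(2) by metis
  next
    case False
    then obtain a b c d a' b' c' d' where "topspace X \<subseteq> {a, b, c, d}" "topspace Y \<subseteq> {a', b', c', d'}"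
      using wide_iff_adj[OF X ne(1)] wide_iff_adj[OF Y ne(2)] adj by metis
    then have "card (topspace X) = 4" "card (topspace Y) = 4" using four assms(5,6) by metis+
    then show ?thesis using four_points_case[OF X _ Y _ iso] False adj by metis
  qed
  then obtain f where f: "homeomorphic_map X Y f" "\<And>U. U \<in> sides X \<Longrightarrow> \<Phi> (cut_of X U) = cut_of Y (f ` U)"
    by blast
  have finj: "inj_on f (topspace X)" and fX: "f ` topspace X = topspace Y"
    using f(1) homeomorphic_imp_injective_map homeomorphic_imp_surjective_map by blast+
  have "\<Phi> {U, V} = {f ` U, f ` V}" if "nonperipheral_cut X {U, V}" for U V
  proof -
    have U: "U \<in> sides X" and V: "V = topspace X - U" using that unfolding nonperipheral_cut_iff by simp_all
    have "f ` V = topspace Y - f ` U"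
      using inj_on_image_set_diff[OF finj Diff_subset sidesD(3)[OF U]] fX V by simp
    then show ?thesis using f(2)[OF U] V unfolding cut_of_def by simp
  qed
  then show ?thesis using f(1) by blast
qed

end
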